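(* Let $\zeta:\{0,1\}\to\{0,1\}^*$ be a non-primitive binary substitution of constant length $q\ge2$ such that $\zeta(0)$ starts with $0$ and such that the fixed point $x=\zeta^\infty(0)$ of $\zeta$ is not eventually $\sigma$-periodic. Let $\mathcal{K}_\ell$ ($\ell\in\mathbb{N}$) be the set of starting points of inner lines of length $\ell$ in the infinite symbolic recurrence plot $\mathcal{R}(x,\infty,1/2)$. Then, for every $\ell\in\mathbb{N}$, the set $\mathcal{K}_\ell$ is infinite (hence nonempty) and has zero density.
   Context: $\mathbb{N}$ = positive integers, $\mathbb{N}_0=\mathbb{N}\cup\{0\}$. A substitution of constant length $q\ge 2$ is a map $\zeta:\{0,1\}\to\{0,1\}^*$ with $|\zeta(0)|=|\zeta(1)|=q$, extended to words and sequences by concatenation. It is primitive if there is $k\ge1$ such that for all letters $a,b$ the letter $b$ occurs in $\zeta^k(a)$. If $\zeta(0)$ starts with $0$, then $\zeta^\infty(0)=\lim_k\zeta^k(0)\in\{0,1\}^{\mathbb{N}_0}$ is the unique fixed point of $\zeta$ starting with $0$. $\sigma$ is the shift; a sequence is eventually $\sigma$-periodic if it has the form $uv^\infty$ with $u,v$ finite words, $v$ nonempty. $\mathcal{R}(x,\infty,1/2)$ is the infinite $0$-$1$ matrix $(\mathcal{R}_{ij})_{i,j\in\mathbb{N}_0}$ with $\mathcal{R}_{ij}=1$ iff $x_i=x_j$. An inner line of length $\ell\in\mathbb{N}$ is a triple $(i,j,\ell)$ with $i,j\in\mathbb{N}$, $i\ne j$, $\mathcal{R}_{i+h,j+h}=1$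 for $0\le h<\ell$, $\mathcal{R}_{i-1,j-1}=0$ and $\mathcal{R}_{i+\ell,j+\ell}=0$; its starting point is $(i,j)$. The density of $M\subseteq\mathbb{N}_0^2$ is $d(M)=\lim_{n\to\infty}n^{-2}\,\#(M\cap\{0,\dots,n-1\}^2)$ when the limit exists. *)

theory Defs
  imports Complex_Main "HOL-Library.Z2"
begin

text \<open>Words are lists and one-sided sequences are functions on \<^typ>\<open>nat\<close>. In the main statement the
  letters are the elements 0 and 1 of \<^typ>\<open>bit\<close>; its field structure plays no role.\<close>

section \<open>Substitutions\<close>

definition constant_length :: "('a \<Rightarrow> 'a list) \<Rightarrow> nat \<Rightarrow> bool" where
  "constant_length \<zeta> q \<longleftrightarrow> q \<ge> 2 \<and> (\<forall>a. length (\<zeta> a) = q)"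

definition subst_word :: "('a \<Rightarrow> 'a list) \<Rightarrow> 'a list \<Rightarrow> 'a list" where
  "subst_word \<zeta> w = concat (map \<zeta> w)"

definition subst_iter :: "('a \<Rightarrow> 'a list) \<Rightarrow> nat \<Rightarrow> 'a \<Rightarrow> 'a list" where
  "subst_iter \<zeta> k a = (subst_word \<zeta> ^^ k) [a]"

definition primitive :: "('a \<Rightarrow> 'a list) \<Rightarrow> bool" where
  "primitive \<zeta> \<longleftrightarrow> (\<exists>k\<ge>1. \<forall>a b. b \<in> set (subst_iter \<zeta> k a))"

text \<open>Convergence of finite words to an infinite sequence: every position is eventually defined
  and eventually carries the letter of the limit.\<close>

definition words_tendsto :: "(nat \<Rightarrow> 'a list) \<Rightarrow> (nat \<Rightarrow> 'a) \<Rightarrow> bool" where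
  "words_tendsto w x \<longleftrightarrow> (\<forall>n. \<forall>\<^sub>F k in sequentially. n < length (w k) \<and> w k ! n = x n)"

text \<open>Meaningful if \<open>\<zeta> a\<close> starts with \<open>a\<close>; see \<open>words_tendsto_subst_limit\<close> below.\<close>

definition subst_limit :: "('a \<Rightarrow> 'a list) \<Rightarrow> 'a \<Rightarrow> nat \<Rightarrow> 'a" where
  "subst_limit \<zeta> a = (THE x. words_tendsto (\<lambda>k. subst_iter \<zeta> k a) x)"

lemma words_tendsto_unique:
  assumes "words_tendsto w x" "words_tendsto w y"
  shows "x = y"
proof
  fix n
  have "\<forall>\<^sub>F k in sequentially. x n = y n"
    using eventually_conj[OF assms(1)[unfolded words_tendsto_def, rule_format, of n]
        assms(2)[unfolded words_tendsto_def, rule_format, of n]]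
    by (rule eventually_mono) metis
  then show "x n = y n" by simp
qed

lemma length_subst_iter:
  assumes "constant_length \<zeta> q"
  shows "length (subst_iter \<zeta> k a) = q ^ k"
proof (induction k)
  case (Suc k)
  have "length (subst_word \<zeta> w) = q * length w" for w
    using assms by (induction w) (auto simp: subst_word_def constant_length_def)
  with Suc show ?case by (simp add: subst_iter_def)
qed (simp add: subst_iter_def)

lemma subst_iter_Suc_prefix:
  assumes "constant_length \<zeta> q" "hd (\<zeta> a) = a"
  shows "\<exists>v. subst_iter \<zeta> (Suc k) a = subst_iter \<zeta> k a @ v"
proof (induction k)
  case 0
  have "length (\<zeta> a) \<ge> 2" using assms(1) by (simp add: constant_length_def)
  then have "\<zeta> a \<noteq> []" by auto
  then have "\<zeta> a = [a] @ tl (\<zeta> a)" using assms(2) by (metis append_Cons append_Nil list.collapse)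
  then show ?case by (auto simp: subst_iter_def subst_word_def)
next
  case (Suc k)
  then obtain v where "subst_iter \<zeta> (Suc k) a = subst_iter \<zeta> k a @ v" by blast
  then have "subst_word \<zeta> (subst_iter \<zeta> (Suc k) a)
      = subst_word \<zeta> (subst_iter \<zeta> k a) @ subst_word \<zeta> v"
    by (simp add: subst_word_def)
  then show ?case by (auto simp: subst_iter_def)
qed

lemma subst_iter_nth_stable:
  assumes "constant_length \<zeta> q" "hd (\<zeta> a) = a" "n < q ^ k" "k \<le> m"
  shows "subst_iter \<zeta> m a ! n = subst_iter \<zeta> k a ! n"
  using assms(4)
proof (induction m rule: dec_induct)
  case (step m)
  have "q ^ k \<le> q ^ m"
    using step.hyps assms(1) by (intro power_increasing) (auto simp: constant_length_def)
  with assms(3) have "n < length (subst_iter \<zeta> m a)"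
    by (simp add: length_subst_iter[OF assms(1)])
  with subst_iter_Suc_prefix[OF assms(1,2), of m] step.IH show ?case
    by (auto simp: nth_append)
qed simp

lemma words_tendsto_subst_limit:
  assumes "constant_length \<zeta> q" "hd (\<zeta> a) = a"
  shows "words_tendsto (\<lambda>k. subst_iter \<zeta> k a) (subst_limit \<zeta> a)"
proof -
  have q: "q \<ge> 2" using assms(1) by (simp add: constant_length_def)
  have lt: "n < q ^ m" if "n \<le> m" for n m
  proof -
    have "n < 2 ^ n" by simp
    also have "\<dots> \<le> q ^ n" using q by (intro power_mono) auto
    also have "\<dots> \<le> q ^ m" using that q by (intro power_increasing) auto
    finally show ?thesis .
  qed
  have "words_tendsto (\<lambda>k. subst_iter \<zeta> k a) (\<lambda>n. subst_iter \<zeta> n a ! n)"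
    unfolding words_tendsto_def eventually_sequentially
  proof (intro allI exI impI conjI)
    fix n k :: nat
    assume "n \<le> k"
    then show "n < length (subst_iter \<zeta> k a)"
      using lt by (simp add: length_subst_iter[OF assms(1)])
    show "subst_iter \<zeta> k a ! n = subst_iter \<zeta> n a ! n"
      using subst_iter_nth_stable[OF assms lt[OF order_refl] \<open>n \<le> k\<close>] .
  qed
  from theI[where P = "words_tendsto (\<lambda>k. subst_iter \<zeta> k a)", OF this words_tendsto_unique[OF _ this]]
  show ?thesis
    unfolding subst_limit_def .
qed


section \<open>Sequences\<close>

definition word_then_power :: "'a list \<Rightarrow> 'a list \<Rightarrow> nat \<Rightarrow> 'a" where
  "word_then_power u v n =
    (if n < length u then u ! n else v ! ((n - length u) mod length v))"

definition eventually_shift_periodic :: "(nat \<Rightarrow> 'a) \<Rightarrow> bool" where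
  "eventually_shift_periodic x \<longleftrightarrow> (\<exists>u v. v \<noteq> [] \<and> x = word_then_power u v)"


section \<open>Recurrence plots and inner lines\<close>

text \<open>The matrix \<open>\<R>(x, \<infinity>, 1/2)\<close>: at threshold 1/2 recurrence amounts to equality of letters.\<close>

definition recurrence_plot :: "(nat \<Rightarrow> 'a) \<Rightarrow> nat \<Rightarrow> nat \<Rightarrow> nat" where
  "recurrence_plot x i j = (if x i = x j then 1 else 0)"

definition inner_line :: "(nat \<Rightarrow> nat \<Rightarrow> nat) \<Rightarrow> nat \<Rightarrow> nat \<Rightarrow> nat \<Rightarrow> bool" where
  "inner_line R i j l \<longleftrightarrow> i \<ge> 1 \<and> j \<ge> 1 \<and> l \<ge> 1 \<and> i \<noteq> j \<and>
    (\<forall>h<l. R (i + h) (j + h) = 1) \<and> R (i - 1) (j - 1) = 0 \<and> R (i + l) (j + l) = 0"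

definition inner_line_starts :: "(nat \<Rightarrow> nat \<Rightarrow> nat) \<Rightarrow> nat \<Rightarrow> (nat \<times> nat) set" where
  "inner_line_starts R l = {(i, j). inner_line R i j l}"


section \<open>Density in the quadrant\<close>

definition has_density :: "(nat \<times> nat) set \<Rightarrow> real \<Rightarrow> bool" where
  "has_density M d \<longleftrightarrow>
    (\<lambda>n. real (card (M \<inter> ({..<n} \<times> {..<n}))) / real n ^ 2) \<longlonglongrightarrow> d"

end

theory Submission
  imports Defs
begin

text \<open>Non-primitivity together with aperiodicity of the fixed point forces \<open>\<zeta>\<close> to map 1 to a block of
  ones, while the image of 0 contains a 1. Hence the zeros of \<open>x\<close> form a Cantor-like set: infinite, of
  density zero, with arbitrarily long gaps. An inner line must be preceded by a mismatch, so one of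
  its coordinates follows a zero, which gives density zero. To obtain inner lines of length \<open>l\<close>,
  compare the beginning \<open>0 1\<^sup>l 1\<close> of one long run of ones with the endings \<open>1 1\<^sup>l 0\<close> of infinitely many
  others.\<close>

section \<open>Inner lines of sequences dominated by one letter\<close>

text \<open>The row \<open>Suc a\<close> stays fixed just after a letter other than
  \<open>b\<close>, with a long run of \<open>b\<close> ahead, while the column \<open>j\<close>
  lies \<open>l\<close> before the end of some run. The mismatch before the line comes from the row
  letter, the one after it from the column letter; the former also keeps the line off the
  diagonal.\<close>

lemma infinite_inner_line_starts:
  fixes x :: "nat \<Rightarrow> 'a"
  assumes runs: "\<And>L N. \<exists>m\<ge>N. \<forall>h<L. x (m + h) = b"
    and others: "\<And>N. \<exists>m\<ge>N. x m \<noteq> b"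
    and l: "l \<ge> 1"
  shows "infinite (inner_line_starts (recurrence_plot x) l)"
proof -
  obtain z where z: "x z \<noteq> b" using others by blast
  obtain m where m: "m \<ge> z" "\<And>h. h < Suc l \<Longrightarrow> x (m + h) = b" using runs[of z "Suc l"] by blast
  \<comment> \<open>The last letter other than \<open>b\<close> up to \<open>m\<close>; it exists
    because \<open>m \<ge> z\<close>.\<close>
  define a where "a = (GREATEST n. n \<le> m \<and> x n \<noteq> b)"
  have a: "a \<le> m" "x a \<noteq> b"
    using GreatestI_nat[of "\<lambda>n. n \<le> m \<and> x n \<noteq> b" z m] z m(1) by (auto simp: a_def)
  have a_max: "n \<le> a" if "n \<le> m" "x n \<noteq> b" for n
    using Greatest_le_nat[of "\<lambda>n. n \<le> m \<and> x n \<noteq> b" n m] that by (auto simp: a_def)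
  \<comment> \<open>One letter more than the line has, so that the row still shows \<open>b\<close>
    at offset \<open>l\<close>. Positions up to \<open>m\<close> follow from maximality of
    \<open>a\<close>, later ones from the run at \<open>m\<close>, as \<open>a < m\<close>.\<close>
  have run_start: "x (Suc a + h) = b" if "h \<le> l" for h
  proof (cases "Suc a + h \<le> m")
    case True
    then show ?thesis using a_max[of "Suc a + h"] by auto
  next
    case False
    have "a \<noteq> m" using a(2) m(2)[of 0] by auto
    then show ?thesis using False a(1) that m(2)[of "Suc a + h - m"] by auto
  qed
  have "\<exists>j\<ge>N. (Suc a, j) \<in> inner_line_starts (recurrence_plot x) l" for N
  proof -
    obtain k where k: "k \<ge> N" "\<And>h. h < Suc l \<Longrightarrow> x (k + h) = b" using runs[of N "Suc l"] by blast
    define e where "e = (LEAST n. n \<ge> k \<and> x n \<noteq> b)"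
    have e: "e \<ge> k" "x e \<noteq> b"
      using LeastI_ex[of "\<lambda>n. n \<ge> k \<and> x n \<noteq> b"] others[of k] by (auto simp: e_def)
    have before_e: "x n = b" if "k \<le> n" "n < e" for n
      using not_less_Least[of n "\<lambda>n. n \<ge> k \<and> x n \<noteq> b"] that by (auto simp: e_def)
    \<comment> \<open>A run of \<open>Suc l\<close> letters leaves room for \<open>j - 1\<close>,
      which must also carry \<open>b\<close>.\<close>
    have gap: "e \<ge> k + Suc l"
      using e k(2)[of "e - k"] by (cases "e - k < Suc l") auto
    define j where "j = e - l"
    have j: "j \<ge> Suc k" "j + l = e" using gap by (auto simp: j_def)
    have run_end: "x (j + h) = b" if "h < l" for h
      using before_e[of "j + h"] j that by auto
    have "x (j - 1) = b" using before_e[of "j - 1"] j l by auto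
    then have "inner_line (recurrence_plot x) (Suc a) j l"
      using a(2) e(2) j l run_start run_start[of l] run_end
      by (auto simp: inner_line_def recurrence_plot_def)
    moreover have "j \<ge> N" using j(1) k(1) by simp
    ultimately show ?thesis unfolding inner_line_starts_def by blast
  qed
  then have "infinite {j. (Suc a, j) \<in> inner_line_starts (recurrence_plot x) l}"
    unfolding finite_nat_set_iff_bounded by (metis mem_Collect_eq not_less)
  moreover have "{j. (Suc a, j) \<in> inner_line_starts (recurrence_plot x) l}
      \<subseteq> snd ` inner_line_starts (recurrence_plot x) l"
    by force
  ultimately show ?thesis by (meson finite_imageI finite_subset)
qed

text \<open>The two letters just before a start differ, so one of them is not \<open>b\<close>.
  Hence the starts in a square of side \<open>n\<close> lie in at most \<open>card (Z n)\<close>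
  rows and as many columns, each of \<open>n\<close> cells.\<close>

lemma has_density_zero_inner_line_starts:
  fixes x :: "nat \<Rightarrow> 'a"
  assumes "(\<lambda>n. real (card {m. m < n \<and> x m \<noteq> b}) / real n) \<longlonglongrightarrow> 0"
  shows "has_density (inner_line_starts (recurrence_plot x) l) 0"
proof -
  define Z where "Z n = {m. m < n \<and> x m \<noteq> b}" for n
  define M where "M = inner_line_starts (recurrence_plot x) l"
  have finite_Z: "finite (Z n)" for n by (simp add: Z_def)
  have card_le: "card (M \<inter> ({..<n} \<times> {..<n})) \<le> 2 * n * card (Z n)" for n
  proof -
    have "M \<inter> ({..<n} \<times> {..<n}) \<subseteq> (Suc ` Z n) \<times> {..<n} \<union> {..<n} \<times> (Suc ` Z n)"
    proof
      fix p assume p: "p \<in> M \<inter> ({..<n} \<times> {..<n})"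
      obtain i j where ij: "p = (i, j)" by fastforce
      have lt: "i < n" "j < n" and pos: "i \<ge> 1" "j \<ge> 1" and ne: "x (i - 1) \<noteq> x (j - 1)"
        using p ij
        by (auto simp: M_def inner_line_starts_def inner_line_def recurrence_plot_def split: if_splits)
      have pred_in: "k \<in> Suc ` Z n" if "k < n" "k \<ge> 1" "x (k - 1) \<noteq> b" for k
        using that by (intro image_eqI[of _ _ "k - 1"]) (auto simp: Z_def)
      show "p \<in> (Suc ` Z n) \<times> {..<n} \<union> {..<n} \<times> (Suc ` Z n)"
        using ij lt pos ne pred_in[of i] pred_in[of j] by (cases "x (i - 1) = b") auto
    qed
    then have "card (M \<inter> ({..<n} \<times> {..<n}))
        \<le> card ((Suc ` Z n) \<times> {..<n} \<union> {..<n} \<times> (Suc ` Z n))"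
      by (intro card_mono) (auto simp: finite_Z)
    also have "\<dots> \<le> card ((Suc ` Z n) \<times> {..<n}) + card ({..<n} \<times> (Suc ` Z n))"
      by (rule card_Un_le)
    also have "\<dots> = 2 * n * card (Z n)"
      by (simp add: card_cartesian_product card_image)
    finally show ?thesis .
  qed
  have "(\<lambda>n. 2 * (real (card (Z n)) / real n)) \<longlonglongrightarrow> 2 * 0"
    using assms unfolding Z_def by (rule tendsto_mult_left)
  then have upper: "(\<lambda>n. 2 * (real (card (Z n)) / real n)) \<longlonglongrightarrow> 0" by simp
  show ?thesis unfolding has_density_def M_def[symmetric]
  proof (rule tendsto_sandwich[OF _ _ tendsto_const upper])
    show "\<forall>\<^sub>F n in sequentially.
        real (card (M \<inter> ({..<n} \<times> {..<n}))) / real n ^ 2 \<le> 2 * (real (card (Z n)) / real n)"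
    proof (rule always_eventually, rule allI)
      fix n
      have "real (card (M \<inter> ({..<n} \<times> {..<n}))) \<le> real (2 * n * card (Z n))"
        using card_le[of n] by linarith
      then have "real (card (M \<inter> ({..<n} \<times> {..<n}))) / real n ^ 2
          \<le> real (2 * n * card (Z n)) / real n ^ 2"
        by (intro divide_right_mono) auto
      \<comment> \<open>For \<open>n = 0\<close> both sides vanish, division by zero being
        zero.\<close>
      then show "real (card (M \<inter> ({..<n} \<times> {..<n}))) / real n ^ 2
          \<le> 2 * (real (card (Z n)) / real n)"
        by (cases "n = 0") (auto simp: power2_eq_square)
    qed
  qed auto
qed


section \<open>Fixed points of substitutions of constant length\<close>

lemma nth_subst_word:
  assumes "constant_length \<zeta> q" "n < length w" "r < q"
  shows "subst_word \<zeta> w ! (q * n + r) = \<zeta> (w ! n) ! r"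
  using assms(2)
proof (induction w arbitrary: n)
  case (Cons c w)
  have len: "length (\<zeta> c) = q" using assms(1) by (simp add: constant_length_def)
  show ?case
  proof (cases n)
    case 0
    then show ?thesis using assms(3) len by (simp add: subst_word_def nth_append)
  next
    case (Suc n')
    then show ?thesis using Cons len by (simp add: subst_word_def nth_append)
  qed
qed simp

text \<open>The fixed point equation read letter by letter.\<close>

lemma subst_limit_nth:
  assumes "constant_length \<zeta> q" "hd (\<zeta> a) = a" "r < q"
  shows "subst_limit \<zeta> a (q * n + r) = \<zeta> (subst_limit \<zeta> a n) ! r"
proof -
  let ?w = "\<lambda>k. subst_iter \<zeta> k a"
  have limit: "\<forall>\<^sub>F k in sequentially. n < length (?w k) \<and> ?w k ! n = subst_limit \<zeta> a n" for n
    using words_tendsto_subst_limit[OF assms(1,2)] by (simp add: words_tendsto_def)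
  have "\<forall>\<^sub>F k in sequentially. subst_limit \<zeta> a (q * n + r) = \<zeta> (subst_limit \<zeta> a n) ! r"
    \<comment> \<open>Index \<open>n\<close> is read in iterate \<open>k\<close>, its image in
      iterate \<open>Suc k\<close>; hence the shift in the second limit.\<close>
    using limit[of n] eventually_sequentially_Suc[THEN iffD2, OF limit[of "q * n + r"]]
  proof eventually_elim
    case (elim k)
    then show ?case
      using nth_subst_word[OF assms(1) _ assms(3), of n "?w k"] by (simp add: subst_iter_def)
  qed
  then show ?thesis by simp
qed

lemma subst_limit_0:
  assumes "constant_length \<zeta> q" "hd (\<zeta> a) = a"
  shows "subst_limit \<zeta> a 0 = a"
proof -
  have "\<forall>\<^sub>F k in sequentially. subst_limit \<zeta> a 0 = a"
    using words_tendsto_subst_limit[OF assms, unfolded words_tendsto_def, rule_format, of 0]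
  proof eventually_elim
    case (elim k)
    then show ?case using subst_iter_nth_stable[OF assms, of 0 0 k] by (simp add: subst_iter_def)
  qed
  then show ?thesis by simp
qed

text \<open>The image of \<open>b\<close> is a block of \<open>b\<close>, so \<open>k\<close>
  applications inflate the occurrence at \<open>p\<close> to a block of length \<open>q ^ k\<close>
  starting at \<open>p * q ^ k\<close>.\<close>

lemma subst_limit_run:
  assumes "constant_length \<zeta> q" "hd (\<zeta> a) = a"
    and "set (\<zeta> b) \<subseteq> {b}" and "subst_limit \<zeta> a p = b" and "r < q ^ k"
  shows "subst_limit \<zeta> a (p * q ^ k + r) = b"
  using assms(5)
proof (induction k arbitrary: r)
  case 0
  then show ?case using assms(4) by simp
next
  case (Suc k)
  have q: "q > 0" "length (\<zeta> b) = q" using assms(1) by (auto simp: constant_length_def)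
  have "r div q < q ^ k" using Suc.prems by (simp add: less_mult_imp_div_less mult.commute)
  then have IH: "subst_limit \<zeta> a (p * q ^ k + r div q) = b" by (rule Suc.IH)
  have "p * q ^ Suc k + r = q * (p * q ^ k + r div q) + r mod q"
    by (simp add: algebra_simps)
  moreover have "r mod q < q" using q by simp
  ultimately have "subst_limit \<zeta> a (p * q ^ Suc k + r) = \<zeta> b ! (r mod q)"
    using subst_limit_nth[OF assms(1,2), of "r mod q"] IH by metis
  also have "\<dots> = b" using assms(3) nth_mem[of "r mod q" "\<zeta> b"] q \<open>r mod q < q\<close> by blast
  finally show ?case .
qed

lemma subst_limit_eq_const:
  assumes "constant_length \<zeta> q" "hd (\<zeta> a) = a" and "set (\<zeta> a) \<subseteq> {a}"
  shows "subst_limit \<zeta> a n = a"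
proof -
  have "q \<ge> 2" using assms(1) by (simp add: constant_length_def)
  then have "n < q ^ n" by (intro power_gt_expt) simp
  from subst_limit_run[OF assms subst_limit_0[OF assms(1,2)] this] show ?thesis by simp
qed

text \<open>Letters other than \<open>b\<close> occur only inside images of such letters, in at most \<open>q - 1\<close> of the \<open>q\<close>
  places of the image.\<close>

lemma card_other_letters_le:
  assumes "constant_length \<zeta> q" "hd (\<zeta> a) = a"
    and "set (\<zeta> b) \<subseteq> {b}" and "\<And>c. b \<in> set (\<zeta> c)"
  shows "card {m. m < n * q ^ k \<and> subst_limit \<zeta> a m \<noteq> b} \<le> (q - 1) ^ k * n"
proof (induction k)
  case 0
  have "card {m. m < n \<and> subst_limit \<zeta> a m \<noteq> b} \<le> card {..<n}" by (intro card_mono) auto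
  then show ?case by simp
next
  case (Suc k)
  let ?x = "subst_limit \<zeta> a"
  let ?Z = "\<lambda>N. {m. m < N \<and> ?x m \<noteq> b}"
  have q: "q > 0" and len: "\<And>c. length (\<zeta> c) = q" using assms(1) by (auto simp: constant_length_def)
  \<comment> \<open>Offsets in the image of \<open>c\<close> not occupied by \<open>b\<close>; at
    least one of the \<open>q\<close> offsets is missing, since every image contains
    \<open>b\<close>.\<close>
  define S where "S c = {r. r < q \<and> \<zeta> c ! r \<noteq> b}" for c
  have card_S: "card (S c) \<le> q - 1" for c
  proof -
    obtain r where "r < q" "\<zeta> c ! r = b" using assms(4)[of c] len[of c] by (metis in_set_conv_nth)
    then have "S c \<subseteq> {..<q} - {r}" by (auto simp: S_def)
    then have "card (S c) \<le> card ({..<q} - {r})" by (intro card_mono) auto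
    then show ?thesis using \<open>r < q\<close> by simp
  qed
  have finite_S: "finite (S c)" for c by (simp add: S_def)
  \<comment> \<open>A position is encoded by its parent \<open>m div q\<close> and offset
    \<open>m mod q\<close>; the parent is not \<open>b\<close>, since \<open>b\<close> produces only
    \<open>b\<close>.\<close>
  have "?Z (n * q ^ Suc k) \<subseteq> (\<lambda>(m, r). q * m + r) ` Sigma (?Z (n * q ^ k)) (\<lambda>m. S (?x m))"
  proof
    fix m assume m: "m \<in> ?Z (n * q ^ Suc k)"
    have val: "?x m = \<zeta> (?x (m div q)) ! (m mod q)"
      using subst_limit_nth[OF assms(1,2), of "m mod q" "m div q"] q by simp
    have "m div q < n * q ^ k"
      using m by (simp add: less_mult_imp_div_less mult.assoc mult.commute[of q])
    moreover have "?x (m div q) \<noteq> b"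
    proof
      assume "?x (m div q) = b"
      then have "?x m \<in> set (\<zeta> b)" using val nth_mem[of "m mod q" "\<zeta> b"] q len by simp
      then show False using m assms(3) by auto
    qed
    moreover have "m mod q \<in> S (?x (m div q))" using m val q by (simp add: S_def)
    ultimately show "m \<in> (\<lambda>(m, r). q * m + r) ` Sigma (?Z (n * q ^ k)) (\<lambda>m. S (?x m))"
      by (intro image_eqI[of _ _ "(m div q, m mod q)"]) auto
  qed
  then have "card (?Z (n * q ^ Suc k)) \<le> card (Sigma (?Z (n * q ^ k)) (\<lambda>m. S (?x m)))"
    by (intro surj_card_le) (auto simp: finite_S)
  also have "\<dots> = (\<Sum>m\<in>?Z (n * q ^ k). card (S (?x m)))"
    by (intro card_SigmaI) (auto simp: finite_S)
  also have "\<dots> \<le> card (?Z (n * q ^ k)) * (q - 1)"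
    using sum_bounded_above[of "?Z (n * q ^ k)" "\<lambda>m. card (S (?x m))" "q - 1"] card_S by simp
  also have "\<dots> \<le> (q - 1) ^ k * n * (q - 1)" using Suc by simp
  finally show ?case by (simp add: algebra_simps)
qed

text \<open>In an initial segment of whole blocks of length \<open>q ^ k\<close> the other letters
  have share at most \<open>\<rho> ^ k\<close> with \<open>\<rho> < 1\<close>. Rounding
  \<open>n\<close> up to whole blocks costs only a constant \<open>C\<close>.\<close>

lemma other_letters_density_zero:
  assumes "constant_length \<zeta> q" "hd (\<zeta> a) = a"
    and "set (\<zeta> b) \<subseteq> {b}" and "\<And>c. b \<in> set (\<zeta> c)"
  shows "(\<lambda>n. real (card {m. m < n \<and> subst_limit \<zeta> a m \<noteq> b}) / real n) \<longlonglongrightarrow> 0"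
proof (rule LIMSEQ_I)
  fix e :: real assume e: "e > 0"
  let ?c = "\<lambda>n. card {m. m < n \<and> subst_limit \<zeta> a m \<noteq> b}"
  have q: "q \<ge> 2" using assms(1) by (simp add: constant_length_def)
  define \<rho> where "\<rho> = real (q - 1) / real q"
  have "\<rho> < 1" using q by (simp add: \<rho>_def)
  then obtain k where k: "\<rho> ^ k < e / 2"
    using real_arch_pow_inv[of "e / 2" \<rho>] e by auto
  define C where "C = real (q - 1) ^ k"
  \<comment> \<open>Beyond this \<open>N\<close> the rounding cost \<open>C\<close> is below
    \<open>e / 2 * n\<close>.\<close>
  obtain N where N: "real N > 2 * C / e" using reals_Archimedean2 by blast
  show "\<exists>N. \<forall>n\<ge>N. norm (real (?c n) / real n - 0) < e"
  proof (intro exI allI impI)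
    fix n assume n: "n \<ge> Suc N"
    define m where "m = n div q ^ k"
    have "n \<le> Suc m * q ^ k"
      using dividend_less_div_times[of "q ^ k" n] q by (simp add: m_def)
    then have "?c n \<le> ?c (Suc m * q ^ k)" by (intro card_mono) auto
    also have "\<dots> \<le> (q - 1) ^ k * Suc m" by (rule card_other_letters_le[OF assms])
    finally have "real (?c n) \<le> real ((q - 1) ^ k * Suc m)" by (rule of_nat_mono)
    also have "\<dots> = C * real (Suc m)" by (simp add: C_def algebra_simps)
    also have "\<dots> \<le> C * (real n / real (q ^ k) + 1)"
      using of_nat_div_le_of_nat[of n "q ^ k"] by (intro mult_left_mono) (auto simp: m_def C_def)
    also have "\<dots> = \<rho> ^ k * real n + C" by (simp add: C_def \<rho>_def power_divide algebra_simps)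
    finally have "real (?c n) \<le> \<rho> ^ k * real n + C" .
    moreover have "\<rho> ^ k * real n < e / 2 * real n" using k n by simp
    moreover have "C < e / 2 * real n"
    proof -
      have "2 * C / e < real n" using N n by linarith
      then show ?thesis using e by (simp add: field_simps)
    qed
    ultimately have "real (?c n) < e * real n" by linarith
    then show "norm (real (?c n) / real n - 0) < e" using n by (simp add: divide_less_eq)
  qed
qed

section \<open>Criteria for eventual periodicity and primitivity\<close>

lemma eventually_shift_periodic_if_eventually_const:
  assumes "\<And>n. n \<ge> N \<Longrightarrow> x n = b"
  shows "eventually_shift_periodic x"
proof -
  have "x = word_then_power (map x [0..<N]) [b]"
    using assms by (auto simp: word_then_power_def fun_eq_iff)
  then show ?thesis unfolding eventually_shift_periodic_def by blast
qed

text \<open>Both images contain 0, whose image contains both letters, so two iterations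
  suffice.\<close>

lemma primitive_if_letters_mixed:
  fixes \<zeta> :: "bit \<Rightarrow> bit list"
  assumes "0 \<in> set (\<zeta> 0)" "1 \<in> set (\<zeta> 0)" "0 \<in> set (\<zeta> 1)"
  shows "primitive \<zeta>"
proof -
  have iter: "set (subst_iter \<zeta> 2 a) = (\<Union>c\<in>set (\<zeta> a). set (\<zeta> c))" for a
    by (auto simp: subst_iter_def subst_word_def numeral_2_eq_2)
  have "b \<in> set (subst_iter \<zeta> 2 a)" for a b
    unfolding iter using assms by (cases a; cases b) auto
  then show ?thesis unfolding primitive_def by (intro exI[of _ 2]) auto
qed

theorem theorem1p3:
  fixes \<zeta> :: "bit \<Rightarrow> bit list" and q :: nat and x :: "nat \<Rightarrow> bit"
  assumes "constant_length \<zeta> q"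
    and "\<not> primitive \<zeta>"
    and "hd (\<zeta> 0) = 0"
    and "x = subst_limit \<zeta> 0"
    and "\<not> eventually_shift_periodic x"
  shows "\<forall>l\<ge>1. infinite (inner_line_starts (recurrence_plot x) l) \<and>
    has_density (inner_line_starts (recurrence_plot x) l) 0"
proof (intro allI impI conjI)
  fix l :: nat assume l: "l \<ge> 1"
  have q: "q \<ge> 2" and len: "length (\<zeta> c) = q" for c
    using assms(1) by (auto simp: constant_length_def)
  have nonempty: "\<zeta> c \<noteq> []" for c using q len[of c] by auto
  \<comment> \<open>Otherwise \<open>x\<close> would be constantly 0.\<close>
  have one_in_0: "1 \<in> set (\<zeta> 0)"
  proof (rule ccontr)
    assume "1 \<notin> set (\<zeta> 0)"
    then have "set (\<zeta> 0) \<subseteq> {0}" by (metis bit_not_one_iff singletonI subsetI)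
    then have "x n = 0" for n using subst_limit_eq_const[OF assms(1,3)] assms(4) by simp
    then show False using eventually_shift_periodic_if_eventually_const[of 0 x 0] assms(5) by blast
  qed
  have "0 \<in> set (\<zeta> 0)" using assms(3) nonempty by (metis hd_in_set)
  then have "0 \<notin> set (\<zeta> 1)" using primitive_if_letters_mixed one_in_0 assms(2) by blast
  then have ones: "set (\<zeta> 1) \<subseteq> {1}" by (metis bit_not_zero_iff singletonI subsetI)
  have one_in: "1 \<in> set (\<zeta> c)" for c
    using one_in_0 ones nonempty[of 1] by (cases c) (metis hd_in_set singletonD subsetD)+
  show "has_density (inner_line_starts (recurrence_plot x) l) 0"
    unfolding assms(4)
    by (rule has_density_zero_inner_line_starts other_letters_density_zero assms(1,3) ones one_in)+
  have others: "\<exists>m\<ge>N. x m \<noteq> 1" for N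
    using eventually_shift_periodic_if_eventually_const[of N x 1] assms(5) by blast
  obtain p where p: "x p = 1"
    using eventually_shift_periodic_if_eventually_const[of 0 x 0] assms(5)
    by (metis bit_not_zero_iff)
  \<comment> \<open>A 1 away from the origin: its inflated blocks start arbitrarily far out.\<close>
  have "p \<noteq> 0" using p subst_limit_0[OF assms(1,3)] assms(4) by (metis zero_neq_one)
  have runs: "\<exists>m\<ge>N. \<forall>h<L. x (m + h) = 1" for L N
  proof (intro exI conjI allI impI)
    \<comment> \<open>The exponent \<open>L + N\<close> makes the block longer than \<open>L\<close>
      and lets it start at or after \<open>N\<close>.\<close>
    have lt: "L + N < q ^ (L + N)" using q by (intro power_gt_expt) simp
    also have "\<dots> \<le> p * q ^ (L + N)" using \<open>p \<noteq> 0\<close> by simp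
    finally show "N \<le> p * q ^ (L + N)" by simp
    fix h assume "h < L"
    then show "x (p * q ^ (L + N) + h) = 1"
      using subst_limit_run[OF assms(1,3) ones, of p h "L + N"] lt p assms(4) by simp
  qed
  show "infinite (inner_line_starts (recurrence_plot x) l)"
    by (rule infinite_inner_line_starts[OF runs others l])
qed

end
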